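(* There are no non-constant tropical entire functions $f_1,\dots,f_n$ that satisfy $$\bigoplus_{j=1}^{n} f_j(x)^{\otimes \alpha_j}=1,\qquad\text{i.e.}\qquad \max_{1\le j\le n}\alpha_j f_j(x)=1\quad\text{for all }x\in\mathbb{R},$$ where the exponents $\alpha_1,\dots,\alpha_n$ are all positive real numbers.
   Context: A tropical meromorphic function is a continuous piecewise linear function $f:\mathbb{R}\to\mathbb{R}$ (with arbitrary real slopes). For $x_0\in\mathbb{R}$ put $\omega_f(x_0)=\lim_{\varepsilon\to0^+}[f'(x_0+\varepsilon)-f'(x_0-\varepsilon)]$; $x_0$ is a root of $f$ of multiplicity $\omega_f(x_0)$ if $\omega_f(x_0)>0$, and a pole of multiplicity $-\omega_f(x_0)$ if $\omega_f(x_0)<0$. A tropical entire function is a tropical meromorphic function without poles. Max-plus notation: $x\oplus y=\max(x,y)$, $x\otimes y=x+y$, $x^{\otimes\alpha}=\alpha x$ for real $\alpha$. The right-hand side $1$ is the real number $1$. *)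

theory Defs
  imports "HOL-Analysis.Analysis"
begin

text \<open>The set \<open>S\<close> of possible breakpoints may be infinite, but it must be locally finite:
  slope changes do not accumulate at a point of the real line.\<close>

definition piecewise_linear :: "(real \<Rightarrow> real) \<Rightarrow> bool" where
  "piecewise_linear f \<longleftrightarrow>
     (\<exists>S. (\<forall>a b. finite (S \<inter> {a..b})) \<and>
          (\<forall>a b. a < b \<longrightarrow> {a<..<b} \<inter> S = {} \<longrightarrow>
                 (\<exists>m c. \<forall>x\<in>{a<..<b}. f x = m * x + c)))"

definition tropical_meromorphic :: "(real \<Rightarrow> real) \<Rightarrow> bool" where
  "tropical_meromorphic f \<longleftrightarrow> continuous_on UNIV f \<and> piecewise_linear f"

text \<open>For a tropical meromorphic \<open>f\<close> the limit below always exists: \<open>f\<close> is affine, hence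
  differentiable, on a punctured neighbourhood of \<open>x\<close>.\<close>

definition trop_omega :: "(real \<Rightarrow> real) \<Rightarrow> real \<Rightarrow> real" where
  "trop_omega f x = Lim (at_right 0) (\<lambda>\<epsilon>. deriv f (x + \<epsilon>) - deriv f (x - \<epsilon>))"

definition trop_pole :: "(real \<Rightarrow> real) \<Rightarrow> real \<Rightarrow> bool" where
  "trop_pole f x \<longleftrightarrow> trop_omega f x < 0"

definition tropical_entire :: "(real \<Rightarrow> real) \<Rightarrow> bool" where
  "tropical_entire f \<longleftrightarrow> tropical_meromorphic f \<and> (\<forall>x. \<not> trop_pole f x)"

end

theory Submission imports Defs begin

text \<open>Absence of poles says that the slope never drops, so a tropical entire function has a local
  supporting line at every point and is therefore convex. The equation forces \<open>f\<^sub>1 \<le> 1 / \<alpha>\<^sub>1\<close>, and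
  a convex function on the whole line that is bounded above is constant.\<close>

lemma deriv_eq_slope:
  fixes f :: "real \<Rightarrow> real"
  assumes "open A" "y \<in> A" "\<And>z. z \<in> A \<Longrightarrow> f z = m * z + c"
  shows "deriv f y = m"
proof -
  have "((\<lambda>z. m * z + c) has_field_derivative m) (at y)"
    by (auto intro!: derivative_eq_intros)
  then have "(f has_field_derivative m) (at y)"
    by (rule has_field_derivative_transform_within_open[OF _ assms(1,2)]) (simp add: assms(3))
  then show ?thesis by (rule DERIV_imp_deriv)
qed

text \<open>Local finiteness of the breakpoints leaves a punctured neighbourhood of \<open>x\<close>
  without any, and continuity glues the two affine pieces at \<open>x\<close>. Anchoring both
  formulas at \<open>f x\<close> leaves the slopes \<open>m1\<close> and \<open>m2\<close> as the
  only data to compare.\<close>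

lemma tropical_meromorphic_locally_affine:
  assumes "tropical_meromorphic f"
  obtains e m1 m2 where "e > 0"
    "\<And>y. x - e < y \<Longrightarrow> y \<le> x \<Longrightarrow> f y = f x + m1 * (y - x)"
    "\<And>y. x \<le> y \<Longrightarrow> y < x + e \<Longrightarrow> f y = f x + m2 * (y - x)"
proof -
  obtain S where fin: "\<And>a b. finite (S \<inter> {a..b})"
    and aff: "\<And>a b. a < b \<Longrightarrow> {a<..<b} \<inter> S = {} \<Longrightarrow> \<exists>m c. \<forall>x\<in>{a<..<b}. f x = m * x + c"
    using assms unfolding tropical_meromorphic_def piecewise_linear_def by metis
  have cont: "isCont f x"
    using assms unfolding tropical_meromorphic_def
    by (simp add: continuous_on_eq_continuous_at)
  \<comment> \<open>Only finitely many breakpoints lie in this window, so those other than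
    \<open>x\<close> keep a positive distance from it. The cap by 1 in \<open>e\<close> keeps the
    neighbourhood inside the window.\<close>
  obtain d where d: "d > 0" "\<And>y. y \<in> S \<inter> {x - 1..x + 1} \<Longrightarrow> y \<noteq> x \<Longrightarrow> d \<le> dist x y"
    using finite_set_avoid[OF fin] by metis
  define e where "e = min d 1"
  have e: "e > 0" using d(1) by (simp add: e_def)
  have disj: "{x - e<..<x} \<inter> S = {}" "{x<..<x + e} \<inter> S = {}"
    using d(2) by (force simp: e_def dist_real_def)+
  obtain m1 c1 where 1: "\<And>y. y \<in> {x - e<..<x} \<Longrightarrow> f y = m1 * y + c1"
    using aff[OF _ disj(1)] e by auto
  obtain m2 c2 where 2: "\<And>y. y \<in> {x<..<x + e} \<Longrightarrow> f y = m2 * y + c2"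
    using aff[OF _ disj(2)] e by auto
  \<comment> \<open>The affine formula is known only on the open interval, so its value at
    \<open>x\<close> comes from comparing two one-sided limits.\<close>
  have "(f \<longlongrightarrow> m1 * x + c1) (at_left x)"
  proof (rule Lim_transform_eventually)
    show "((\<lambda>y. m1 * y + c1) \<longlongrightarrow> m1 * x + c1) (at_left x)"
      by (intro tendsto_intros)
    show "\<forall>\<^sub>F y in at_left x. m1 * y + c1 = f y"
      using eventually_at_left_real[of "x - e" x] e by (auto elim!: eventually_mono simp: 1)
  qed
  moreover have "(f \<longlongrightarrow> f x) (at_left x)"
    using cont unfolding isCont_def by (rule filterlim_mono) (auto simp: at_le)
  ultimately have fx1: "f x = m1 * x + c1"
    by (metis tendsto_unique trivial_limit_at_left_real)
  have "(f \<longlongrightarrow> m2 * x + c2) (at_right x)"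
  proof (rule Lim_transform_eventually)
    show "((\<lambda>y. m2 * y + c2) \<longlongrightarrow> m2 * x + c2) (at_right x)"
      by (intro tendsto_intros)
    show "\<forall>\<^sub>F y in at_right x. m2 * y + c2 = f y"
      using eventually_at_right_real[of x "x + e"] e by (auto elim!: eventually_mono simp: 2)
  qed
  moreover have "(f \<longlongrightarrow> f x) (at_right x)"
    using cont unfolding isCont_def by (rule filterlim_mono) (auto simp: at_le)
  ultimately have fx2: "f x = m2 * x + c2"
    by (metis tendsto_unique trivial_limit_at_right_real)
  show thesis
  proof (rule that[OF e])
    show "f y = f x + m1 * (y - x)" if "x - e < y" "y \<le> x" for y
      using that 1[of y] fx1 by (cases "y = x") (auto simp: algebra_simps)
    show "f y = f x + m2 * (y - x)" if "x \<le> y" "y < x + e" for y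
      using that 2[of y] fx2 by (cases "y = x") (auto simp: algebra_simps)
  qed
qed

text \<open>The expression under the limit is constant for \<open>t\<close> in
  \<open>{0<..<e}\<close>, so it converges to that constant; uniqueness of limits then evaluates
  \<open>Lim\<close>.\<close>

lemma trop_omega_eq_slope_diff:
  assumes "e > 0"
    and left: "\<And>y. x - e < y \<Longrightarrow> y \<le> x \<Longrightarrow> f y = f x + m1 * (y - x)"
    and right: "\<And>y. x \<le> y \<Longrightarrow> y < x + e \<Longrightarrow> f y = f x + m2 * (y - x)"
  shows "trop_omega f x = m2 - m1"
proof -
  have "deriv f (x + t) - deriv f (x - t) = m2 - m1" if "t \<in> {0<..<e}" for t
  proof -
    have "f z = m2 * z + (f x - m2 * x)" if "z \<in> {x<..<x + e}" for z
      using right[of z] that by (simp add: right_diff_distrib)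
    then have "deriv f (x + t) = m2"
      using \<open>t \<in> {0<..<e}\<close> by (intro deriv_eq_slope[of "{x<..<x + e}"]) auto
    moreover have "f z = m1 * z + (f x - m1 * x)" if "z \<in> {x - e<..<x}" for z
      using left[of z] that by (simp add: right_diff_distrib)
    then have "deriv f (x - t) = m1"
      using \<open>t \<in> {0<..<e}\<close> by (intro deriv_eq_slope[of "{x - e<..<x}"]) auto
    ultimately show ?thesis by simp
  qed
  then have "\<forall>\<^sub>F t in at_right 0. m2 - m1 = deriv f (x + t) - deriv f (x - t)"
    using eventually_at_right_real[OF \<open>e > 0\<close>] by (auto elim!: eventually_mono)
  then have "((\<lambda>t. deriv f (x + t) - deriv f (x - t)) \<longlongrightarrow> m2 - m1) (at_right 0)"
    by (rule Lim_transform_eventually[OF tendsto_const])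
  then show ?thesis
    unfolding trop_omega_def by (intro tendsto_Lim) auto
qed

text \<open>The left slope serves as \<open>m\<close>: the line agrees with \<open>f\<close> on the
  left of \<open>x\<close> and stays below it on the right, since the absence of a pole means
  \<open>m1 \<le> m2\<close>.\<close>

lemma tropical_entire_local_support:
  assumes "tropical_entire f"
  obtains e m where "e > 0" "\<And>y. \<bar>y - x\<bar> < e \<Longrightarrow> f x + m * (y - x) \<le> f y"
proof -
  have mero: "tropical_meromorphic f"
    using assms by (simp add: tropical_entire_def)
  obtain e m1 m2 where e: "e > 0"
    and left: "\<And>y. x - e < y \<Longrightarrow> y \<le> x \<Longrightarrow> f y = f x + m1 * (y - x)"
    and right: "\<And>y. x \<le> y \<Longrightarrow> y < x + e \<Longrightarrow> f y = f x + m2 * (y - x)"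
    by (rule tropical_meromorphic_locally_affine[OF mero, of x]) (rule that)
  have "trop_omega f x = m2 - m1"
    using e left right by (rule trop_omega_eq_slope_diff)
  moreover have "0 \<le> trop_omega f x"
    using assms by (simp add: tropical_entire_def trop_pole_def not_less)
  ultimately have le: "m1 \<le> m2" by simp
  have "f x + m1 * (y - x) \<le> f y" if y: "\<bar>y - x\<bar> < e" for y
  proof (cases "y \<le> x")
    case True
    then have "f y = f x + m1 * (y - x)"
      using y by (intro left) linarith+
    then show ?thesis by linarith
  next
    case False
    then have "f y = f x + m2 * (y - x)"
      using y by (intro right) linarith+
    moreover have "m1 * (y - x) \<le> m2 * (y - x)"
      using le False by (intro mult_right_mono) linarith+
    ultimately show ?thesis by linarith
  qed
  then show thesis using that e by metis
qed

text \<open>At the leftmost maximum of \<open>f\<close> minus its chord, a local supporting line would have to be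
  strictly increasing and so exceed the maximum on the right.\<close>

lemma local_support_imp_convex:
  fixes f :: "real \<Rightarrow> real"
  assumes cont: "continuous_on UNIV f"
    and supp: "\<And>x. \<exists>e>0. \<exists>m. \<forall>y. \<bar>y - x\<bar> < e \<longrightarrow> f x + m * (y - x) \<le> f y"
  shows "convex_on UNIV f"
proof (rule convex_on_linorderI)
  fix t a b :: real
  assume t: "0 < t" "t < 1" and ab: "a < b"
  define k where "k = (f b - f a) / (b - a)"
  \<comment> \<open>Subtracting the chord through the endpoints reduces the convexity inequality to
    \<open>g \<le> 0\<close> on \<open>{a..b}\<close>.\<close>
  define g where "g y = f y - f a - k * (y - a)" for y
  have gab: "g a = 0" "g b = 0" using ab by (auto simp: g_def k_def)
  have contg: "continuous_on {a..b} g"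
    unfolding g_def by (intro continuous_intros continuous_on_subset[OF cont]) auto
  obtain p where p: "p \<in> {a..b}" "\<And>y. y \<in> {a..b} \<Longrightarrow> g y \<le> g p"
    using continuous_attains_sup[OF _ _ contg] ab by auto
  have g_le: "g p \<le> 0"
  proof (rule ccontr)
    assume pos: "\<not> g p \<le> 0"
    define C where "C = {y \<in> {a..b}. g y = g p}"
    have "compact C"
    proof -
      have "closed C"
        unfolding C_def using continuous_closed_preimage_constant[OF contg] by simp
      moreover have "bounded C"
        by (rule bounded_subset[of "{a..b}"]) (auto simp: C_def)
      ultimately show ?thesis by (simp add: compact_eq_bounded_closed)
    qed
    moreover have "C \<noteq> {}" using p(1) by (auto simp: C_def)
    \<comment> \<open>The maximisers form a nonempty compact set, so a leftmost one exists. It is an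
      interior point because \<open>g\<close> vanishes at both endpoints while its maximum is
      positive.\<close>
    ultimately obtain q where q: "q \<in> C" "\<And>y. y \<in> C \<Longrightarrow> q \<le> y"
      using compact_attains_inf by metis
    have gq: "g q = g p" and "a \<le> q" "q \<le> b" using q(1) by (auto simp: C_def)
    then have qab: "a < q" "q < b"
      using gab pos by (auto simp: order.order_iff_strict)
    obtain e m where e: "e > 0" and m: "\<And>y. \<bar>y - q\<bar> < e \<Longrightarrow> f q + m * (y - q) \<le> f y"
      using supp[of q] by metis
    define h where "h = min (e / 2) (min (q - a) (b - q))"
    have h: "0 < h" "h < e" "a \<le> q - h" "q + h \<le> b"
      using e qab by (auto simp: h_def)
    have gm: "g q + (m - k) * (y - q) \<le> g y" if "\<bar>y - q\<bar> < e" for y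
      using m[OF that] by (simp add: g_def algebra_simps)
    \<comment> \<open>The inequality is strict because \<open>q - h\<close> lies to the left of the
      leftmost maximiser. The supporting line then has slope \<open>m - k > 0\<close>, which pushes
      \<open>g (q + h)\<close> above the maximum.\<close>
    have "g (q - h) < g p"
      using p(2)[of "q - h"] q(2)[of "q - h"] h qab
      by (force simp: C_def less_le)
    moreover have "g p - (m - k) * h \<le> g (q - h)"
      using gm[of "q - h"] h gq by (simp add: algebra_simps)
    moreover have "g p + (m - k) * h \<le> g (q + h)"
      using gm[of "q + h"] h gq by (simp add: algebra_simps)
    moreover have "g (q + h) \<le> g p"
      using p(2)[of "q + h"] h qab by auto
    ultimately show False by linarith
  qed
  define z where "z = (1 - t) * a + t * b"
  have za: "z - a = t * (b - a)" by (simp add: z_def algebra_simps)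
  have zb: "b - z = (1 - t) * (b - a)" by (simp add: z_def algebra_simps)
  have "0 \<le> z - a" "0 \<le> b - z" unfolding za zb using t ab by simp_all
  then have "g z \<le> 0"
    using p(2)[of z] g_le by simp
  moreover have "k * (z - a) = t * (f b - f a)"
    unfolding za k_def using ab by simp
  ultimately have "f z \<le> f a + t * (f b - f a)"
    by (simp add: g_def)
  then show "f ((1 - t) *\<^sub>R a + t *\<^sub>R b) \<le> (1 - t) * f a + t * f b"
    by (simp add: z_def algebra_simps)
qed simp

lemma tropical_entire_imp_convex:
  assumes "tropical_entire f"
  shows "convex_on UNIV f"
proof (rule local_support_imp_convex)
  show "continuous_on UNIV f"
    using assms by (simp add: tropical_entire_def tropical_meromorphic_def)
  show "\<exists>e>0. \<exists>m. \<forall>y. \<bar>y - x\<bar> < e \<longrightarrow> f x + m * (y - x) \<le> f y" for x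
    by (rule tropical_entire_local_support[OF assms, of x]) blast
qed

text \<open>If \<open>f b > f a\<close>, convexity makes \<open>f\<close> grow at least linearly
  along the ray from \<open>a\<close> beyond \<open>b\<close>, past any bound \<open>K\<close>. Only
  the line through \<open>a\<close> and \<open>b\<close> matters, so any real vector space will
  do.\<close>

lemma convex_bounded_above_imp_constant:
  fixes f :: "'a::real_vector \<Rightarrow> real"
  assumes conv: "convex_on UNIV f" and bdd: "\<And>x. f x \<le> K"
  shows "f constant_on UNIV"
proof -
  have le: "f b \<le> f a" for a b
  proof (rule ccontr)
    assume "\<not> f b \<le> f a"
    then have pos: "0 < f b - f a" by simp
    \<comment> \<open>With this \<open>t\<close> the line through the values at \<open>a\<close> and
      \<open>b\<close> reaches height \<open>K + (f b - f a)\<close> at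
      \<open>a + t *\<^sub>R (b - a)\<close>. Since \<open>t \<ge> 1\<close>, \<open>b\<close> is a
      convex combination of \<open>a\<close> and that point, with weight \<open>1 / t\<close> on the
      latter.\<close>
    define t where "t = 1 + (K - f a) / (f b - f a)"
    have t: "t \<ge> 1" using pos bdd[of a] by (simp add: t_def)
    have "f ((1 - 1 / t) *\<^sub>R a + (1 / t) *\<^sub>R (a + t *\<^sub>R (b - a)))
            \<le> (1 - 1 / t) * f a + (1 / t) * f (a + t *\<^sub>R (b - a))"
      using convex_onD[OF conv, of "1 / t" a] t by simp
    also have "(1 - 1 / t) *\<^sub>R a + (1 / t) *\<^sub>R (a + t *\<^sub>R (b - a)) = b"
      using t by (simp add: algebra_simps)
    also have "(1 / t) * f (a + t *\<^sub>R (b - a)) \<le> (1 / t) * K"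
      using t bdd by (intro mult_left_mono) auto
    finally have "t * (f b - f a) \<le> K - f a"
      using t by (simp add: field_simps)
    moreover have "t * (f b - f a) = (f b - f a) + (K - f a)"
      using pos by (simp add: t_def field_simps)
    ultimately show False using pos by linarith
  qed
  show ?thesis
    unfolding constant_on_def using le by (metis order_antisym)
qed

theorem theorem2p2:
  fixes n :: nat and \<alpha> :: "nat \<Rightarrow> real"
  assumes "n \<ge> 1"
    and "\<And>j. j \<in> {1..n} \<Longrightarrow> \<alpha> j > 0"
  shows "\<not> (\<exists>f :: nat \<Rightarrow> real \<Rightarrow> real.
            (\<forall>j\<in>{1..n}. tropical_entire (f j) \<and> \<not> f j constant_on UNIV) \<and>
            (\<forall>x. Max ((\<lambda>j. \<alpha> j * f j x) ` {1..n}) = 1))"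
proof
  assume "\<exists>f :: nat \<Rightarrow> real \<Rightarrow> real.
            (\<forall>j\<in>{1..n}. tropical_entire (f j) \<and> \<not> f j constant_on UNIV) \<and>
            (\<forall>x. Max ((\<lambda>j. \<alpha> j * f j x) ` {1..n}) = 1)"
  then obtain f :: "nat \<Rightarrow> real \<Rightarrow> real"
    where ent: "\<And>j. j \<in> {1..n} \<Longrightarrow> tropical_entire (f j) \<and> \<not> f j constant_on UNIV"
      and max: "\<And>x. Max ((\<lambda>j. \<alpha> j * f j x) ` {1..n}) = 1"
    by metis
  \<comment> \<open>A single index suffices for the contradiction: the maximum bounds each term from
    above, and \<open>\<alpha> 1 > 0\<close> turns this into an upper bound on
    \<open>f 1\<close>.\<close>
  have 1: "1 \<in> {1..n}" using assms(1) by simp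
  have "f 1 x \<le> 1 / \<alpha> 1" for x
  proof -
    have "\<alpha> 1 * f 1 x \<le> Max ((\<lambda>j. \<alpha> j * f j x) ` {1..n})"
      using 1 by (intro Max_ge) auto
    with max[of x] assms(2)[OF 1] show ?thesis by (simp add: field_simps)
  qed
  then show False
    using ent[OF 1] convex_bounded_above_imp_constant tropical_entire_imp_convex by blast
qed

end
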